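(* Let $K$ be a field, $\kappa,\lambda\in K$, let $(A,\mu,\alpha,\beta)$ be a BiHom-commutative BiHom-associative algebra and let $\mathfrak D:A\to A$ be a $\lambda$-$(\mathrm{id},\mathrm{id})$-derivation such that any two of the maps $\alpha,\beta,\mathfrak D$ commute. Define $a\ast b=a\mathfrak D(b)+\kappa ab$ for $a,b\in A$. Then $(A,\mu,\ast,\alpha,\beta)$ is a BiHom-Novikov-Poisson algebra.
   Context: BiHom-associative algebra $(A,\mu,\alpha,\beta)$: a $K$-vector space with linear $\mu:A\otimes A\to A$ (written $ab$), $\alpha,\beta:A\to A$ such that $\alpha\beta=\beta\alpha$, $\alpha(ab)=\alpha(a)\alpha(b)$, $\beta(ab)=\beta(a)\beta(b)$, $\alpha(a)(bc)=(ab)\beta(c)$. BiHom-commutative: $\beta(a)\alpha(b)=\beta(b)\alpha(a)$ for all $a,b$. $\lambda$-$(\mathrm{id},\mathrm{id})$-derivation: a linear $\mathfrak D:A\to A$ with $\mathfrak D(ab)=a\mathfrak D(b)+\mathfrak D(a)b+\lambda ab$. (Left) BiHom-pre-Lie algebra $(A,\circ,\alpha,\beta)$: bilinear $\circ$, commuting linear $\alpha,\beta$ multiplicative for $\circ$, with $\alpha\beta(a)\circ(\alpha(b)\circ c)-(\beta(a)\circ\alpha(b))\circ\beta(c)=\alpha\beta(b)\circ(\alpha(a)\circ c)-(\beta(b)\circ\alpha(a))\circ\beta(c)$. It is a BiHom-Novikov algebra if moreover $(a\circ\beta(b))\circ\alpha\beta(c)=(a\circ\beta(c))\circ\alpha\beta(b)$.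 BiHom-Novikov-Poisson algebra $(A,\cdot,\ast,\alpha,\beta)$: (1) $(A,\cdot,\alpha,\beta)$ is a BiHom-commutative BiHom-associative algebra; (2) $(A,\ast,\alpha,\beta)$ is a BiHom-Novikov algebra; (3) for all $a,b,c\in A$: $(\beta(a)\ast\alpha(b))\cdot\beta(c)-\alpha\beta(a)\ast(\alpha(b)\cdot c)=(\beta(b)\ast\alpha(a))\cdot\beta(c)-\alpha\beta(b)\ast(\alpha(a)\cdot c)$, $(a\cdot\beta(b))\ast\alpha\beta(c)=(a\ast\beta(c))\cdot\alpha\beta(b)$, $\alpha(a)\cdot(b\ast c)=(a\cdot b)\ast\beta(c)$. *)

theory Defs
  imports Main "HOL.Vector_Spaces"
begin

text \<open>The underlying vector space \<open>A\<close> is a whole type \<open>'a\<close>, with scalar multiplication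
  \<open>scale\<close> over an arbitrary field \<open>'k\<close>. A linear map \<open>A \<otimes> A \<rightarrow> A\<close> is given by the
  corresponding bilinear map in curried form.\<close>

definition bilinear_op ::
  "('k::field \<Rightarrow> 'a::ab_group_add \<Rightarrow> 'a) \<Rightarrow> ('a \<Rightarrow> 'a \<Rightarrow> 'a) \<Rightarrow> bool" where
  "bilinear_op scale m \<longleftrightarrow>
    (\<forall>a. Vector_Spaces.linear scale scale (\<lambda>b. m a b)) \<and>
    (\<forall>b. Vector_Spaces.linear scale scale (\<lambda>a. m a b))"

locale bihom_algebra = vector_space scale
  for scale :: "'k::field \<Rightarrow> 'a::ab_group_add \<Rightarrow> 'a" +
  fixes mult :: "'a \<Rightarrow> 'a \<Rightarrow> 'a" (infixl \<open>\<bullet>\<close> 70)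
    and \<alpha> \<beta> :: "'a \<Rightarrow> 'a"
  assumes bilinear_mult: "bilinear_op scale (\<bullet>)"
    and linear_alpha: "Vector_Spaces.linear scale scale \<alpha>"
    and linear_beta: "Vector_Spaces.linear scale scale \<beta>"
    and alpha_beta_commute: "\<alpha> \<circ> \<beta> = \<beta> \<circ> \<alpha>"
    and alpha_mult: "\<alpha> (a \<bullet> b) = \<alpha> a \<bullet> \<alpha> b"
    and beta_mult: "\<beta> (a \<bullet> b) = \<beta> a \<bullet> \<beta> b"

locale bihom_associative = bihom_algebra +
  assumes bihom_assoc: "\<alpha> a \<bullet> (b \<bullet> c) = (a \<bullet> b) \<bullet> \<beta> c"

locale bihom_commutative_associative = bihom_associative +
  assumes bihom_comm: "\<beta> a \<bullet> \<alpha> b = \<beta> b \<bullet> \<alpha> a"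

locale bihom_pre_lie = bihom_algebra +
  assumes bihom_left_symmetric:
    "\<alpha> (\<beta> a) \<bullet> (\<alpha> b \<bullet> c) - (\<beta> a \<bullet> \<alpha> b) \<bullet> \<beta> c =
     \<alpha> (\<beta> b) \<bullet> (\<alpha> a \<bullet> c) - (\<beta> b \<bullet> \<alpha> a) \<bullet> \<beta> c"

locale bihom_novikov = bihom_pre_lie +
  assumes bihom_right_commute:
    "(a \<bullet> \<beta> b) \<bullet> \<alpha> (\<beta> c) = (a \<bullet> \<beta> c) \<bullet> \<alpha> (\<beta> b)"

locale bihom_novikov_poisson =
  bihom_commutative_associative scale dot \<alpha> \<beta> +
  novikov: bihom_novikov scale star \<alpha> \<beta>
  for scale :: "'k::field \<Rightarrow> 'a::ab_group_add \<Rightarrow> 'a"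
    and dot :: "'a \<Rightarrow> 'a \<Rightarrow> 'a" (infixl \<open>\<bullet>\<close> 70)
    and star :: "'a \<Rightarrow> 'a \<Rightarrow> 'a" (infixl \<open>\<star>\<close> 70)
    and \<alpha> \<beta> :: "'a \<Rightarrow> 'a" +
  assumes star_dot_left_symmetric:
    "(\<beta> a \<star> \<alpha> b) \<bullet> \<beta> c - \<alpha> (\<beta> a) \<star> (\<alpha> b \<bullet> c) =
     (\<beta> b \<star> \<alpha> a) \<bullet> \<beta> c - \<alpha> (\<beta> b) \<star> (\<alpha> a \<bullet> c)"
    and dot_star_right_commute:
    "(a \<bullet> \<beta> b) \<star> \<alpha> (\<beta> c) = (a \<star> \<beta> c) \<bullet> \<alpha> (\<beta> b)"
    and dot_star_assoc: "\<alpha> a \<bullet> (b \<star> c) = (a \<bullet> b) \<star> \<beta> c"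

text \<open>A \<open>\<lambda>\<close>-derivation with respect to \<open>(id, id)\<close>, where \<open>l\<close> is the weight \<open>\<lambda>\<close>.\<close>

definition id_id_derivation ::
  "('k::field \<Rightarrow> 'a::ab_group_add \<Rightarrow> 'a) \<Rightarrow> ('a \<Rightarrow> 'a \<Rightarrow> 'a) \<Rightarrow> 'k \<Rightarrow> ('a \<Rightarrow> 'a) \<Rightarrow> bool" where
  "id_id_derivation scale m l D \<longleftrightarrow>
    Vector_Spaces.linear scale scale D \<and>
    (\<forall>a b. D (m a b) = m a (D b) + m (D a) b + scale l (m a b))"

end

theory Submission
  imports Defs
begin

text \<open>BiHom-commutativity and BiHom-associativity combine to the two symmetries
  \<open>\<alpha>\<beta>(a)(\<alpha>(b)c) = \<alpha>\<beta>(b)(\<alpha>(a)c)\<close> and \<open>(a\<beta>(b))\<alpha>\<beta>(c) = (a\<beta>(c))\<alpha>\<beta>(b)\<close>.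
  In the left-symmetry axioms the terms containing a factor \<open>\<alpha>D(b)\<close> in the middle position
  cancel, and every other term of each axiom is an instance of one of the two symmetries.\<close>

lemma bilinear_opI:
  assumes "vector_space scale"
    and "\<And>a b c. m a (b + c) = m a b + m a c"
    and "\<And>a b c. m (a + b) c = m a c + m b c"
    and "\<And>r a b. m a (scale r b) = scale r (m a b)"
    and "\<And>r a b. m (scale r a) b = scale r (m a b)"
  shows "bilinear_op scale m"
  using assms
  by (simp add: bilinear_op_def Vector_Spaces.linear_def module_hom_def module_hom_axioms_def
      module_iff_vector_space)

context bihom_algebra
begin

lemma mult_add_right: "a \<bullet> (b + c) = a \<bullet> b + a \<bullet> c"
  and mult_add_left: "(a + b) \<bullet> c = a \<bullet> c + b \<bullet> c"
  and mult_scale_right: "a \<bullet> scale r b = scale r (a \<bullet> b)"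
  and mult_scale_left: "scale r a \<bullet> b = scale r (a \<bullet> b)"
  using bilinear_mult
  by (simp_all add: bilinear_op_def Vector_Spaces.linear_def module_hom_def module_hom_axioms_def)

lemmas mult_linear_simps = mult_add_right mult_add_left mult_scale_right mult_scale_left

end

context bihom_commutative_associative
begin

lemma mult_left_commute: "\<alpha> (\<beta> a) \<bullet> (\<alpha> b \<bullet> c) = \<alpha> (\<beta> b) \<bullet> (\<alpha> a \<bullet> c)"
  by (simp add: bihom_assoc bihom_comm)

lemma mult_right_commute: "(a \<bullet> \<beta> b) \<bullet> \<alpha> (\<beta> c) = (a \<bullet> \<beta> c) \<bullet> \<alpha> (\<beta> b)"
proof -
  have "(a \<bullet> \<beta> b) \<bullet> \<beta> (\<alpha> c) = (a \<bullet> \<beta> c) \<bullet> \<beta> (\<alpha> b)"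
    by (simp flip: bihom_assoc add: bihom_comm[of b c])
  then show ?thesis
    using alpha_beta_commute by (simp add: fun_eq_iff)
qed

end

theorem proposition3p14:
  fixes scale :: "'k::field \<Rightarrow> 'a::ab_group_add \<Rightarrow> 'a"
    and \<mu> :: "'a \<Rightarrow> 'a \<Rightarrow> 'a"
    and \<alpha> \<beta> D :: "'a \<Rightarrow> 'a"
    and \<kappa> l :: 'k
  assumes "bihom_commutative_associative scale \<mu> \<alpha> \<beta>"
    and "id_id_derivation scale \<mu> l D"
    and "\<alpha> \<circ> \<beta> = \<beta> \<circ> \<alpha>"
    and "\<alpha> \<circ> D = D \<circ> \<alpha>"
    and "\<beta> \<circ> D = D \<circ> \<beta>"
  shows "bihom_novikov_poisson scale \<mu> (\<lambda>a b. \<mu> a (D b) + scale \<kappa> (\<mu> a b)) \<alpha> \<beta>"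
proof -
  interpret bihom_commutative_associative scale \<mu> \<alpha> \<beta> by fact
  interpret linear_D: Vector_Spaces.linear scale scale D
    using assms(2) by (simp add: id_id_derivation_def)
  interpret linear_\<alpha>: Vector_Spaces.linear scale scale \<alpha> by (rule linear_alpha)
  interpret linear_\<beta>: Vector_Spaces.linear scale scale \<beta> by (rule linear_beta)
  have D_mult: "D (\<mu> a b) = \<mu> a (D b) + \<mu> (D a) b + scale l (\<mu> a b)" for a b
    using assms(2) by (simp add: id_id_derivation_def)
  have D_alpha: "D (\<alpha> a) = \<alpha> (D a)" and D_beta: "D (\<beta> a) = \<beta> (D a)" for a
    using assms(4,5) by (simp_all add: fun_eq_iff)
  note linear_simps = mult_linear_simps linear_D.add linear_D.scale linear_\<alpha>.add linear_\<alpha>.scale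
    linear_\<beta>.add linear_\<beta>.scale scale_right_distrib
  note expand = linear_simps D_mult D_alpha D_beta
  let ?star = "\<lambda>a b. \<mu> a (D b) + scale \<kappa> (\<mu> a b)"
  show ?thesis
  proof unfold_locales
    show "bilinear_op scale ?star"
      by (rule bilinear_opI) (unfold_locales, simp_all add: linear_simps algebra_simps scale_left_commute)
  next
    show "\<alpha> (?star a b) = ?star (\<alpha> a) (\<alpha> b)" and "\<beta> (?star a b) = ?star (\<beta> a) (\<beta> b)" for a b
      by (simp_all add: expand alpha_mult beta_mult)
  next
    show "?star (\<alpha> (\<beta> a)) (?star (\<alpha> b) c) - ?star (?star (\<beta> a) (\<alpha> b)) (\<beta> c) =
      ?star (\<alpha> (\<beta> b)) (?star (\<alpha> a) c) - ?star (?star (\<beta> b) (\<alpha> a)) (\<beta> c)" for a b c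
      by (simp add: expand flip: bihom_assoc)
        (simp add: mult_left_commute[of a b])
  next
    show "?star (?star a (\<beta> b)) (\<alpha> (\<beta> c)) = ?star (?star a (\<beta> c)) (\<alpha> (\<beta> b))" for a b c
      by (simp add: expand mult_right_commute[of a _ "D b"] mult_right_commute[of a _ b] algebra_simps)
  next
    show "\<mu> (?star (\<beta> a) (\<alpha> b)) (\<beta> c) - ?star (\<alpha> (\<beta> a)) (\<mu> (\<alpha> b) c) =
      \<mu> (?star (\<beta> b) (\<alpha> a)) (\<beta> c) - ?star (\<alpha> (\<beta> b)) (\<mu> (\<alpha> a) c)" for a b c
      by (simp add: expand flip: bihom_assoc)
        (simp add: mult_left_commute[of a b])
  next
    show "?star (\<mu> a (\<beta> b)) (\<alpha> (\<beta> c)) = \<mu> (?star a (\<beta> c)) (\<alpha> (\<beta> b))" for a b c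
      by (simp add: expand mult_right_commute[of a b])
  next
    show "\<mu> (\<alpha> a) (?star b c) = ?star (\<mu> a b) (\<beta> c)" for a b c
      by (simp add: expand bihom_assoc)
  qed fact
qed

end
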